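(* Let $\Gamma$ be a girth-regular graph of valence $k$, girth $g$ and signature $(a_1,\ldots,a_k)$. Then $a_k \le (k-1)^d$, where $d=\lfloor g/2\rfloor$.
   Context: Graphs are finite and simple. For a graph $\Gamma$ of finite girth $g$, a girth cycle is a cycle of length $g$, and for an edge $e$, $\epsilon(e)$ denotes the number of girth cycles containing $e$. If $v$ is a vertex with incident edges $e_1,\ldots,e_k$ ordered so that $\epsilon(e_1)\le\cdots\le\epsilon(e_k)$, the signature of $v$ is the $k$-tuple $(\epsilon(e_1),\ldots,\epsilon(e_k))$. A graph is girth-regular if all its vertices have the same signature; this common tuple is the signature of the graph (in particular a girth-regular graph is regular). *)

theory Defs
  imports "Graph_Theory.Graph_Theory" "HOL-Library.Extended_Nat" "HOL-Library.Multiset"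
begin

text \<open>
  A finite simple graph is a \<^locale>\<open>pair_graph\<close>: a finite, loop-free, symmetric set of arcs.
  An undirected edge is the two-element set of its ends, represented by two opposite arcs.
\<close>

definition edges :: "'a pair_pre_digraph \<Rightarrow> 'a set set" where
  "edges G = {{u, v} | u v. (u, v) \<in> parcs G}"

definition incident_edges :: "'a pair_pre_digraph \<Rightarrow> 'a \<Rightarrow> 'a set set" where
  "incident_edges G v = {e \<in> edges G. v \<in> e}"

definition has_valence :: "'a pair_pre_digraph \<Rightarrow> nat \<Rightarrow> bool" where
  "has_valence G k \<longleftrightarrow> (\<forall>v \<in> pverts G. card (incident_edges G v) = k)"

text \<open>
  The library's notion of cycle also admits the closed walk of length 2 that
  traverses an edge back and forth; it is not a cycle of the undirected graph.
\<close>

definition graph_cycle :: "'a pair_pre_digraph \<Rightarrow> ('a \<times> 'a) list \<Rightarrow> bool" where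
  "graph_cycle G p \<longleftrightarrow> pre_digraph.cycle (with_proj G) p \<and> 3 \<le> length p"

definition girth :: "'a pair_pre_digraph \<Rightarrow> enat" where
  "girth G = (INF p \<in> {p. graph_cycle G p}. enat (length p))"

text \<open>
  As a subgraph, a cycle is determined by its set of edges; counting edge sets
  identifies the closed walks that differ only in starting point or direction.
\<close>

definition edges_of_walk :: "('a \<times> 'a) list \<Rightarrow> 'a set set" where
  "edges_of_walk p = {{u, v} | u v. (u, v) \<in> set p}"

definition girth_cycles :: "'a pair_pre_digraph \<Rightarrow> 'a set set set" where
  "girth_cycles G = {edges_of_walk p | p. graph_cycle G p \<and> enat (length p) = girth G}"

definition eps :: "'a pair_pre_digraph \<Rightarrow> 'a set \<Rightarrow> nat" where
  "eps G e = card {C \<in> girth_cycles G. e \<in> C}"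

definition vertex_signature :: "'a pair_pre_digraph \<Rightarrow> 'a \<Rightarrow> nat list" where
  "vertex_signature G v =
     sorted_list_of_multiset (image_mset (eps G) (mset_set (incident_edges G v)))"

definition girth_regular :: "'a pair_pre_digraph \<Rightarrow> bool" where
  "girth_regular G \<longleftrightarrow> girth G \<noteq> \<infinity> \<and>
     (\<forall>u \<in> pverts G. \<forall>v \<in> pverts G. vertex_signature G u = vertex_signature G v)"

definition has_signature :: "'a pair_pre_digraph \<Rightarrow> nat list \<Rightarrow> bool" where
  "has_signature G a \<longleftrightarrow> (\<forall>v \<in> pverts G. vertex_signature G v = a)"

end

theory Submission
  imports Defs
begin

text \<open>
  Fix an edge \<open>uv\<close> and put \<open>d = \<lfloor>g/2\<rfloor>\<close>. Traverse a girth cycle through \<open>uv\<close> from \<open>v\<close> to \<open>u\<close> and then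
  \<open>d\<close> steps further: there are at most \<open>(k-1)^d\<close> non-backtracking walks of this shape. The rest
  of the cycle is a path back to \<open>v\<close> of length \<open>g - 1 - d\<close>. Two distinct such paths with the same
  ends would close up to a cycle of length at most \<open>2 (g - 1 - d) < g\<close>, so the cycle is determined
  by its initial walk.
\<close>

section \<open>Cycles as sequences of vertices\<close>

lemma pawalk_verts_if_pcas: "pcas u p v \<Longrightarrow> pawalk_verts u p = u # map snd p"
  by (induction p arbitrary: u) auto

lemma pcas_iff_nth:
  assumes "p \<noteq> []"
  shows "pcas u p v \<longleftrightarrow> fst (p ! 0) = u \<and> snd (p ! (length p - 1)) = v \<and>
    (\<forall>i. Suc i < length p \<longrightarrow> snd (p ! i) = fst (p ! Suc i))"
  using assms
proof (induction p arbitrary: u)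
  case Nil
  then show ?case by simp
next
  case (Cons e p)
  show ?case
  proof (cases "p = []")
    case True
    then show ?thesis by auto
  next
    case False
    have split: "(\<forall>i<n. P i) \<longleftrightarrow> P 0 \<and> (\<forall>i. Suc i < n \<longrightarrow> P (Suc i))"
      if "n > 0" for n and P :: "nat \<Rightarrow> bool"
      using that by (metis not0_implies_Suc)
    show ?thesis
      using False by (auto simp: Cons.IH[OF False] split)
  qed
qed

context pair_graph
begin

text \<open>On a walk, the vertex list without its first entry is the list of heads of the arcs, so
  the library's distinctness condition on a cycle becomes one on \<open>map snd p\<close>.\<close>

lemma graph_cycle_iff:
  "graph_cycle G p \<longleftrightarrow> 3 \<le> length p \<and> set p \<subseteq> parcs G \<and> distinct (map snd p) \<and>
     snd (p ! (length p - 1)) = fst (p ! 0) \<and>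
     (\<forall>i. Suc i < length p \<longrightarrow> snd (p ! i) = fst (p ! Suc i))"
proof (cases "p = []")
  case True
  then show ?thesis by (simp add: graph_cycle_def)
next
  case False
  have "fst (p ! 0) \<in> pverts G" if "set p \<subseteq> parcs G"
    using False that arc_fst_in_verts by (metis length_greater_0_conv nth_mem subsetD)
  then show ?thesis
    using False
    by (auto simp: graph_cycle_def cycle_def awalk_def pcas_iff_nth pawalk_verts_if_pcas)
qed

text \<open>This is how a closed stretch of a walk yields a cycle, and hence an upper bound on the
  girth.\<close>

lemma graph_cycle_of_vertices:
  assumes "3 \<le> n" and "\<And>i. i < n \<Longrightarrow> (f i, f (Suc i)) \<in> parcs G"
    and "inj_on f {..<n}" and "f n = f 0"
  shows "graph_cycle G (map (\<lambda>i. (f i, f (Suc i))) [0..<n])"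
proof -
  \<comment> \<open>The heads are the values at \<open>1, ..., n\<close>; since
    \<open>f n = f 0\<close>, they are the values at \<open>0, ..., n - 1\<close> in another
    order.\<close>
  have "inj_on (\<lambda>i. f (Suc i)) {0..<n}"
  proof (rule inj_onI)
    fix i j assume ij: "i \<in> {0..<n}" "j \<in> {0..<n}" "f (Suc i) = f (Suc j)"
    have inj: "a = b" if "f a = f b" "a < n" "b < n" for a b
      using assms(3) that by (auto dest: inj_onD)
    have "Suc i < n \<or> Suc i = n" "Suc j < n \<or> Suc j = n" using ij by auto
    then show "i = j"
      using ij inj[of "Suc i" "Suc j"] inj[of 0 "Suc j"] inj[of "Suc i" 0] assms(1,4) by auto
  qed
  then show ?thesis
    using assms by (auto simp: graph_cycle_iff distinct_map comp_def)
qed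

text \<open>
  Periodic labellings by all integers make changes of starting point and of direction mere
  substitutions in the index.
\<close>

definition cyclic_labelling :: "nat \<Rightarrow> (int \<Rightarrow> 'a) \<Rightarrow> 'a set set \<Rightarrow> bool" where
  "cyclic_labelling n c C \<longleftrightarrow> (\<forall>i. (c i, c (i + 1)) \<in> parcs G) \<and>
     (\<forall>i j. c i = c j \<longleftrightarrow> i mod int n = j mod int n) \<and> C = (\<lambda>i. {c i, c (i + 1)}) ` UNIV"

lemma parcs_sym: "(x, y) \<in> parcs G \<Longrightarrow> (y, x) \<in> parcs G"
  using pair_sym_arcs by (metis symmetric_def symD with_proj_simps(3))

lemma cyclic_labelling_shift:
  assumes "cyclic_labelling n c C"
  shows "cyclic_labelling n (\<lambda>i. c (i + s)) C"
proof -
  have "(\<lambda>i. {c i, c (i + 1)}) ` UNIV = (\<lambda>i. {c (i + s), c (i + 1 + s)}) ` UNIV"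
    (is "range ?l = range ?r")
  proof -
    have "?r = ?l \<circ> (\<lambda>i. i + s)" by (auto simp: add_ac)
    moreover have "range (\<lambda>i::int. i + s) = UNIV" by simp
    ultimately show ?thesis by (metis image_comp)
  qed
  moreover have "(c (i + s), c (i + 1 + s)) \<in> parcs G" for i
  proof -
    have "i + 1 + s = i + s + 1" by simp
    then show ?thesis using assms unfolding cyclic_labelling_def by metis
  qed
  moreover have "(i + s) mod int n = (j + s) mod int n \<longleftrightarrow> i mod int n = j mod int n" for i j
    by (simp add: mod_eq_dvd_iff)
  ultimately show ?thesis
    using assms unfolding cyclic_labelling_def by simp
qed

lemma cyclic_labelling_reverse:
  assumes "cyclic_labelling n c C"
  shows "cyclic_labelling n (\<lambda>i. c (- i)) C"
proof -
  have "(\<lambda>i. {c i, c (i + 1)}) ` UNIV = (\<lambda>i. {c (- i), c (- (i + 1))}) ` UNIV"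
    (is "range ?l = range ?r")
  proof -
    \<comment> \<open>Edge \<open>i\<close> of the reversed labelling is edge \<open>- 1 - i\<close>
      of the original one.\<close>
    have "?r = ?l \<circ> (\<lambda>i. - 1 - i)"
    proof
      fix i :: int
      have "- 1 - i + 1 = - i" "- (i + 1) = - 1 - i" by auto
      then show "?r i = (?l \<circ> (\<lambda>i. - 1 - i)) i"
        unfolding comp_def by (metis insert_commute)
    qed
    moreover have "range (\<lambda>i::int. - 1 - i) = UNIV" by simp
    ultimately show ?thesis by (metis image_comp)
  qed
  moreover have "(c (- i), c (- (i + 1))) \<in> parcs G" for i
  proof -
    have "(c (- i - 1), c (- i - 1 + 1)) \<in> parcs G"
      using assms unfolding cyclic_labelling_def by blast
    then show ?thesis using parcs_sym by simp
  qed
  moreover have "(- i) mod int n = (- j) mod int n \<longleftrightarrow> i mod int n = j mod int n" for i j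
    by (simp add: mod_eq_dvd_iff dvd_diff_commute)
  ultimately show ?thesis
    using assms unfolding cyclic_labelling_def by simp
qed

text \<open>The label of \<open>i\<close> is the tail of the arc whose position is \<open>i\<close>
  modulo the length; the closing condition of the cycle handles the wrap-around.\<close>

lemma graph_cycle_labelling:
  assumes "graph_cycle G p"
  shows "\<exists>c. cyclic_labelling (length p) c (edges_of_walk p)"
proof -
  define n where "n = length p"
  define c where "c i = fst (p ! nat (i mod int n))" for i
  note p = assms[unfolded graph_cycle_iff, folded n_def]
  have n: "3 \<le> n" using p by blast
  have c_Suc: "c (i + 1) = snd (p ! nat (i mod int n))" for i
  proof -
    define m where "m = nat (i mod int n)"
    have m: "m < n" "i mod int n = int m" using n by (auto simp: m_def nat_less_iff)
    have "(i + 1) mod int n = (int m + 1) mod int n"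
      using m(2) by (metis mod_add_left_eq)
    also have "\<dots> = int (Suc m mod n)" by (simp add: zmod_int add.commute)
    finally have "c (i + 1) = fst (p ! (Suc m mod n))" by (simp add: c_def)
    also have "\<dots> = snd (p ! m)"
    proof (cases "Suc m < n")
      case True
      then show ?thesis using p by simp
    next
      case False
      then have "Suc m = n" using m by simp
      then show ?thesis using p by (metis diff_Suc_1 mod_self)
    qed
    finally show ?thesis by (simp add: m_def)
  qed
  have nth: "(c i, c (i + 1)) = p ! nat (i mod int n)" for i
    by (subst c_Suc) (simp add: c_def)
  have lt: "nat (i mod int n) < n" for i using n by (simp add: nat_less_iff)
  have arcs: "(c i, c (i + 1)) \<in> parcs G" for i
    unfolding nth using p lt by (auto simp: n_def)
  have inj: "i mod int n = j mod int n" if "c i = c j" for i j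
  proof -
    \<comment> \<open>Distinctness is known for heads, whereas \<open>c\<close> is defined by tails;
      so both vertices are read as heads of the preceding arcs.\<close>
    have "snd (p ! nat ((i - 1) mod int n)) = snd (p ! nat ((j - 1) mod int n))"
      using that c_Suc[of "i - 1"] c_Suc[of "j - 1"] by simp
    then have "nat ((i - 1) mod int n) = nat ((j - 1) mod int n)"
      using p lt by (metis n_def length_map nth_eq_iff_index_eq nth_map)
    then have "(i - 1) mod int n = (j - 1) mod int n"
      using n by (simp add: nat_eq_iff)
    then have "(i - 1 + 1) mod int n = (j - 1 + 1) mod int n"
      by (rule mod_add_cong) simp
    then show ?thesis by simp
  qed
  have inj_conv: "c i = c j" if "i mod int n = j mod int n" for i j
    using that by (simp add: c_def)
  have set_p: "set p = range (\<lambda>i. (c i, c (i + 1)))"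
  proof
    show "set p \<subseteq> range (\<lambda>i. (c i, c (i + 1)))"
    proof
      fix e assume "e \<in> set p"
      then obtain m where "m < n" "e = p ! m" by (metis in_set_conv_nth n_def)
      then have "e = (c (int m), c (int m + 1))" by (simp add: nth)
      then show "e \<in> range (\<lambda>i. (c i, c (i + 1)))" by blast
    qed
    show "range (\<lambda>i. (c i, c (i + 1))) \<subseteq> set p"
      unfolding nth using lt by (auto simp: n_def)
  qed
  have "edges_of_walk p = (\<lambda>(u, v). {u, v}) ` set p"
    unfolding edges_of_walk_def by auto
  also have "\<dots> = range (\<lambda>i. {c i, c (i + 1)})"
    unfolding set_p by (simp add: image_image)
  finally have "edges_of_walk p = range (\<lambda>i. {c i, c (i + 1)})" .
  then have "cyclic_labelling n c (edges_of_walk p)"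
    unfolding cyclic_labelling_def
    by (intro conjI allI iffI) (rule arcs, erule inj, erule inj_conv)
  then show ?thesis unfolding n_def by blast
qed

text \<open>A shift, followed by a reversal if the edge is traversed the other way, makes all girth
  cycles through one edge start with the same two vertices.\<close>

lemma girth_cycle_labelling_at:
  assumes "C \<in> girth_cycles G" and "girth G = enat g" and "{u, v} \<in> C"
  shows "\<exists>c. cyclic_labelling g c C \<and> c 0 = v \<and> c 1 = u"
proof -
  obtain c where c: "cyclic_labelling g c C"
    using assms graph_cycle_labelling unfolding girth_cycles_def by fastforce
  then obtain i where "{u, v} = {c i, c (i + 1)}"
    using assms(3) unfolding cyclic_labelling_def by auto
  then consider "c i = v" "c (i + 1) = u" | "c i = u" "c (i + 1) = v"
    by (auto simp: doubleton_eq_iff)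
  then show ?thesis
  proof cases
    case 1
    then show ?thesis
      using cyclic_labelling_shift[OF c, of i]
      by (intro exI[of _ "\<lambda>j. c (j + i)"]) (simp add: add.commute)
  next
    \<comment> \<open>The shift by \<open>i + 1\<close> puts \<open>v\<close> at index 0 and
      \<open>u\<close> at index -1; the reversal then moves \<open>u\<close> to index 1.\<close>
    case 2
    then show ?thesis
      using cyclic_labelling_reverse[OF cyclic_labelling_shift[OF c, of "i + 1"]]
      by (intro exI[of _ "\<lambda>j. c (- j + (i + 1))"]) simp
  qed
qed

lemma girth_ge_3: "girth G = enat g \<Longrightarrow> 3 \<le> g"
proof -
  assume g: "girth G = enat g"
  have "enat 3 \<le> girth G"
    unfolding girth_def by (rule INF_greatest) (auto simp: graph_cycle_def)
  then show "3 \<le> g" using g by simp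
qed

section \<open>Non-backtracking walks\<close>

text \<open>Here \<open>n\<close> counts arcs, so the walk consists of the values of
  \<open>f\<close> at \<open>0, ..., n\<close>.\<close>

definition nonbacktracking :: "(nat \<Rightarrow> 'a) \<Rightarrow> nat \<Rightarrow> bool" where
  "nonbacktracking f n \<longleftrightarrow> (\<forall>i<n. (f i, f (Suc i)) \<in> parcs G) \<and>
     (\<forall>i. Suc (Suc i) \<le> n \<longrightarrow> f i \<noteq> f (Suc (Suc i)))"

lemma nonbacktracking_mono: "nonbacktracking f n \<Longrightarrow> m \<le> n \<Longrightarrow> nonbacktracking f m"
  unfolding nonbacktracking_def by auto

text \<open>Equal labels at distance 2 would make \<open>g\<close> divide 2. The offset
  \<open>s\<close> serves both the initial walk and the way back to its start.\<close>

lemma nonbacktracking_labelling: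
  assumes "cyclic_labelling g c C" and "3 \<le> g"
  shows "nonbacktracking (\<lambda>i. c (int i + s)) n"
proof -
  have "c i \<noteq> c (i + 2)" for i
  proof
    assume "c i = c (i + 2)"
    then have "(i + 2) mod int g = i mod int g"
      using assms(1) unfolding cyclic_labelling_def by metis
    then have "int g dvd 2" by (simp add: mod_eq_dvd_iff)
    then show False using assms(2) zdvd_imp_le by fastforce
  qed
  moreover have "(c i, c (i + 1)) \<in> parcs G" for i
    using assms(1) unfolding cyclic_labelling_def by blast
  moreover have "int (Suc i) + s = int i + s + 1" "int (Suc (Suc i)) + s = int i + s + 2" for i
    by auto
  ultimately show ?thesis
    unfolding nonbacktracking_def by presburger
qed

text \<open>A closest pair of equal vertices on the walk bounds a cycle.\<close>

lemma nonbacktracking_inj_on: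
  assumes "nonbacktracking f n" and "enat n < girth G"
  shows "inj_on f {..n}"
proof (rule ccontr)
  assume "\<not> inj_on f {..n}"
  then obtain a b where "a < b" "b \<le> n" "f a = f b"
    unfolding inj_on_def by (metis atMost_iff linorder_neqE_nat)
  then have ex: "\<exists>l>0. \<exists>i. i + l \<le> n \<and> f i = f (i + l)"
    by (intro exI[of _ "b - a"] conjI exI[of _ a]) auto
  define l where "l = (LEAST l. l > 0 \<and> (\<exists>i. i + l \<le> n \<and> f i = f (i + l)))"
  have l: "l > 0 \<and> (\<exists>i. i + l \<le> n \<and> f i = f (i + l))"
    unfolding l_def using ex by (rule LeastI_ex)
  then obtain i where i: "i + l \<le> n" "f i = f (i + l)" by blast
  have minimal: "l \<le> m" if "m > 0" "j + m \<le> n" "f j = f (j + m)" for j m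
    unfolding l_def by (rule Least_le) (use that in blast)
  have arcs: "(f j, f (Suc j)) \<in> parcs G" if "j < n" for j
    using assms(1) that unfolding nonbacktracking_def by blast
  \<comment> \<open>A return after one step is a loop and a return after two steps is a backtrack,
    so the closed stretch is long enough for a cycle.\<close>
  have "l \<noteq> 1" using i arcs[of i] pair_no_loops[of "(f i, f (Suc i))"] by auto
  moreover have "l \<noteq> 2" using i assms(1) unfolding nonbacktracking_def by auto
  ultimately have "3 \<le> l" using l by linarith
  moreover have "inj_on (\<lambda>j. f (i + j)) {..<l}"
  proof (rule linorder_inj_onI)
    fix x y assume xy: "x < y" "x \<in> {..<l}" "y \<in> {..<l}"
    show "f (i + x) \<noteq> f (i + y)"
      using minimal[of "y - x" "i + x"] xy i by auto
  qed auto
  ultimately have "graph_cycle G (map (\<lambda>j. (f (i + j), f (i + Suc j))) [0..<l])"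
    using i arcs by (intro graph_cycle_of_vertices) auto
  then have "girth G \<le> enat (length (map (\<lambda>j. (f (i + j), f (i + Suc j))) [0..<l]))"
    unfolding girth_def by (intro INF_lower) blast
  then have "girth G \<le> enat l" by simp
  also have "\<dots> \<le> enat n" using i by simp
  finally show False using assms(2) by simp
qed

text \<open>
  If the two walks still differ just before their common last vertex, the first one followed by
  the reversal of the second one does not backtrack there.
\<close>

lemma nonbacktracking_unique:
  assumes "nonbacktracking p m" and "nonbacktracking q m" and "p 0 = q 0" and "p m = q m"
    and "enat (2 * m) < girth G" and "i \<le> m"
  shows "p i = q i"
  using assms
proof (induction m arbitrary: i)
  case 0
  then show ?case by simp
next
  case (Suc m)
  \<comment> \<open>The index \<open>2 * Suc m - i\<close> runs \<open>q\<close> backwards. At the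
    junction \<open>Suc m\<close> both branches agree because the walks end at the same vertex,
    which gives \<open>q'\<close>.\<close>
  define f where "f i = (if i \<le> Suc m then p i else q (2 * Suc m - i))" for i
  have q': "f j = q (2 * Suc m - j)" if "j \<ge> Suc m" for j
    using that Suc.prems(4) by (auto simp: f_def le_Suc_eq)
  have p_nb: "\<And>j. j < Suc m \<Longrightarrow> (p j, p (Suc j)) \<in> parcs G"
      "\<And>j. Suc j \<le> m \<Longrightarrow> p j \<noteq> p (Suc (Suc j))"
    and q_nb: "\<And>j. j < Suc m \<Longrightarrow> (q j, q (Suc j)) \<in> parcs G"
      "\<And>j. Suc j \<le> m \<Longrightarrow> q j \<noteq> q (Suc (Suc j))"
    using Suc.prems(1,2) unfolding nonbacktracking_def by auto
  show ?case
  proof (cases "p m = q m")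
    case True
    have "p j = q j" if "j \<le> m" for j
    proof (rule Suc.IH)
      show "enat (2 * m) < girth G"
        by (rule le_less_trans[OF _ Suc.prems(5)]) simp
    qed (use Suc.prems True that in \<open>auto intro: nonbacktracking_mono\<close>)
    then show ?thesis using Suc.prems(4,6) by (auto simp: le_Suc_eq)
  next
    case False
    have "nonbacktracking f (2 * Suc m)"
      unfolding nonbacktracking_def
    proof (intro conjI allI impI)
      fix j assume j: "j < 2 * Suc m"
      show "(f j, f (Suc j)) \<in> parcs G"
      proof (cases "j < Suc m")
        case True
        then show ?thesis using p_nb(1) by (simp add: f_def)
      next
        case False
        define t where "t = 2 * Suc m - Suc j"
        have "2 * Suc m - j = Suc t" "t < Suc m" using j False by (auto simp: t_def)
        then show ?thesis
          using False q'[of j] q'[of "Suc j"] q_nb(1)[of t] parcs_sym by (simp add: t_def)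
      qed
    next
      fix j assume j: "Suc (Suc j) \<le> 2 * Suc m"
      consider "Suc j \<le> m" | "j = m" | "Suc m \<le> j" by linarith
      then show "f j \<noteq> f (Suc (Suc j))"
      proof cases
        case 1
        then show ?thesis using p_nb(2) by (simp add: f_def)
      next
        case 2
        then show ?thesis using \<open>p m \<noteq> q m\<close> by (simp add: f_def)
      next
        case 3
        define t where "t = 2 * Suc m - Suc (Suc j)"
        have "2 * Suc m - j = Suc (Suc t)" "Suc t \<le> m" using j 3 by (auto simp: t_def)
        then show ?thesis
          using 3 q'[of j] q'[of "Suc (Suc j)"] q_nb(2)[of t] by (simp add: t_def)
      qed
    qed
    then have "inj_on f {..2 * Suc m}" using Suc.prems(5) by (rule nonbacktracking_inj_on)
    \<comment> \<open>The combined walk starts at \<open>p 0\<close> and ends at \<open>q 0\<close>,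
      which are equal; this contradicts injectivity, so the case cannot occur.\<close>
    moreover have "f 0 = f (2 * Suc m)" using Suc.prems(3) by (simp add: f_def)
    ultimately show ?thesis by (auto dest: inj_onD)
  qed
qed

section \<open>Counting non-backtracking walks with a prescribed first arc\<close>

lemma card_neighbours:
  assumes "has_valence G k" and "x \<in> pverts G"
  shows "card {y. (x, y) \<in> parcs G} = k"
proof -
  have "incident_edges G x = (\<lambda>y. {x, y}) ` {y. (x, y) \<in> parcs G}"
    using parcs_sym unfolding incident_edges_def edges_def by (auto simp: insert_commute)
  moreover have "inj_on (\<lambda>y. {x, y}) {y. (x, y) \<in> parcs G}"
    by (auto simp: inj_on_def doubleton_eq_iff)
  ultimately show ?thesis
    using assms card_image unfolding has_valence_def by fastforce
qed

lemma finite_neighbours: "finite {y. (x, y) \<in> parcs G}"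
proof -
  have "{y. (x, y) \<in> parcs G} \<subseteq> snd ` parcs G" by force
  then show ?thesis using pair_finite_arcs finite_surj by blast
qed

text \<open>Lists replace functions so that walks agreeing on the relevant indices are counted once.
  The parameter \<open>n\<close> counts the steps after the one from \<open>v\<close> to
  \<open>u\<close>.\<close>

definition walks_from :: "'a \<Rightarrow> 'a \<Rightarrow> nat \<Rightarrow> 'a list set" where
  "walks_from v u n =
     {map f [0..<Suc (Suc n)] | f. nonbacktracking f (Suc n) \<and> f 0 = v \<and> f 1 = u}"

text \<open>By induction: a walk is extended by a neighbour of its last vertex other than the vertex
  just before it, which leaves at most \<open>k - 1\<close> choices.\<close>

lemma card_walks_from:
  assumes "has_valence G k"
  shows "finite (walks_from v u n) \<and> card (walks_from v u n) \<le> (k - 1) ^ n"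
proof (induction n)
  case 0
  have "walks_from v u 0 \<subseteq> {[v, u]}" by (auto simp: walks_from_def)
  then show ?case
    using card_mono[of "{[v, u]}"] by (auto intro: finite_subset)
next
  case (Suc n)
  define next_vertices where
    "next_vertices xs = {y. (xs ! Suc n, y) \<in> parcs G} - {xs ! n}" for xs :: "'a list"
  define ext where "ext xs = (\<lambda>y. xs @ [y]) ` next_vertices xs" for xs
  have fin: "finite (ext xs)" for xs
    unfolding ext_def next_vertices_def using finite_neighbours by simp
  have card_ext: "card (ext xs) \<le> k - 1" if xs: "xs \<in> walks_from v u n" for xs
  proof -
    obtain f where f: "xs = map f [0..<Suc (Suc n)]" "nonbacktracking f (Suc n)"
      using xs unfolding walks_from_def by blast
    then have nth: "xs ! n = f n" "xs ! Suc n = f (Suc n)"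
      by (auto simp del: upt_Suc)
    \<comment> \<open>The excluded vertex is itself a neighbour of the last one, so excluding it
      lowers the count from \<open>k\<close> to \<open>k - 1\<close>.\<close>
    have arc: "(f (Suc n), f n) \<in> parcs G"
      using f(2) parcs_sym unfolding nonbacktracking_def by blast
    then have "card {y. (f (Suc n), y) \<in> parcs G} = k"
      using card_neighbours[OF assms] in_arcsD1 by blast
    then have "card (next_vertices xs) = k - 1"
      using arc finite_neighbours unfolding next_vertices_def nth by (simp add: card_Diff_singleton)
    then show ?thesis
      unfolding ext_def using card_image_le[of "next_vertices xs"] finite_neighbours
      by (metis finite_Diff next_vertices_def)
  qed
  have sub: "walks_from v u (Suc n) \<subseteq> (\<Union>xs\<in>walks_from v u n. ext xs)"
  proof
    fix ys assume "ys \<in> walks_from v u (Suc n)"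
    then obtain f where f: "ys = map f [0..<Suc (Suc (Suc n))]"
        "nonbacktracking f (Suc (Suc n))" "f 0 = v" "f 1 = u"
      unfolding walks_from_def by blast
    define xs where "xs = map f [0..<Suc (Suc n)]"
    have xs: "xs \<in> walks_from v u n"
      unfolding walks_from_def xs_def
      using f nonbacktracking_mono[OF f(2), of "Suc n"] by auto
    have ys: "ys = xs @ [f (Suc (Suc n))]" unfolding f(1) xs_def by simp
    have "xs ! n = f n" "xs ! Suc n = f (Suc n)"
      unfolding xs_def by (auto simp del: upt_Suc)
    then have "f (Suc (Suc n)) \<in> next_vertices xs"
      using f(2) unfolding next_vertices_def nonbacktracking_def
      by (metis (mono_tags, lifting) Diff_iff lessI mem_Collect_eq order_refl singletonD)
    then have "ys \<in> ext xs" unfolding ys ext_def by blast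
    then show "ys \<in> (\<Union>xs\<in>walks_from v u n. ext xs)" using xs by blast
  qed
  have fin_U: "finite (\<Union>xs\<in>walks_from v u n. ext xs)" using Suc.IH fin by blast
  have "card (walks_from v u (Suc n)) \<le> card (\<Union>xs\<in>walks_from v u n. ext xs)"
    by (rule card_mono[OF fin_U sub])
  also have "\<dots> \<le> (\<Sum>xs\<in>walks_from v u n. card (ext xs))"
    using Suc.IH by (intro card_UN_le) blast
  also have "\<dots> \<le> card (walks_from v u n) * (k - 1)"
    using sum_bounded_above[of "walks_from v u n" "\<lambda>xs. card (ext xs)" "k - 1"] card_ext by simp
  also have "\<dots> \<le> (k - 1) ^ n * (k - 1)" using Suc.IH by simp
  finally show ?case using finite_subset[OF sub fin_U] by (simp add: mult.commute)
qed

section \<open>Counting girth cycles through an edge\<close>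

text \<open>Past index \<open>s = g div 2 + 1\<close>, both labellings follow non-backtracking walks
  of length \<open>g - s\<close> with common ends. As \<open>2 * (g - s) < g\<close> for either
  parity of \<open>g\<close>, these walks coincide, and periodicity extends the agreement to all
  integers.\<close>

lemma labelling_determined_by_half:
  assumes "girth G = enat g"
    and c: "cyclic_labelling g c C" and c': "cyclic_labelling g c' C'"
    and eq: "\<And>i. i < g div 2 + 2 \<Longrightarrow> c (int i) = c' (int i)"
  shows "C = C'"
proof -
  define s where "s = g div 2 + 1"
  have g: "3 \<le> g" using girth_ge_3 assms(1) .
  have s: "s \<le> g" "2 * (g - s) < g" using g by (auto simp: s_def)
  have period: "c i = c (i mod int g)" "c' i = c' (i mod int g)" for i
    using c c' unfolding cyclic_labelling_def by (metis mod_mod_trivial)+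
  \<comment> \<open>The index is \<open>g\<close>, which is congruent to 0, where the labellings
    agree by assumption.\<close>
  have last: "c (int (g - s) + int s) = c' (int (g - s) + int s)"
    using period[of "int g"] eq[of 0] s by (simp add: of_nat_diff)
  have "c (int j) = c' (int j)" if "j < g" for j
  proof (cases "j \<le> s")
    case True
    then show ?thesis using eq by (simp add: s_def)
  next
    case False
    have "c (int (j - s) + int s) = c' (int (j - s) + int s)"
    proof (rule nonbacktracking_unique[where m = "g - s"
          and p = "\<lambda>i. c (int i + int s)" and q = "\<lambda>i. c' (int i + int s)"])
      show "nonbacktracking (\<lambda>i. c (int i + int s)) (g - s)"
        "nonbacktracking (\<lambda>i. c' (int i + int s)) (g - s)"
        using nonbacktracking_labelling c c' g by blast+
      show "c (int 0 + int s) = c' (int 0 + int s)" using eq[of s] by (simp add: s_def)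
      show "enat (2 * (g - s)) < girth G" using s assms(1) by simp
    qed (use last that in auto)
    then show ?thesis using False by (simp add: of_nat_diff)
  qed
  moreover have "nat (i mod int g) < g" "int (nat (i mod int g)) = i mod int g" for i
    using g by (auto simp: nat_less_iff)
  ultimately have "c i = c' i" for i
    using period[of i] by metis
  then have "c = c'" by blast
  then show ?thesis using c c' unfolding cyclic_labelling_def by simp
qed

text \<open>Sending a girth cycle to the initial walk of its chosen labelling injects the cycles
  through the edge into \<open>walks_from v u (g div 2)\<close>.\<close>

lemma eps_le:
  assumes "girth G = enat g" and "has_valence G k"
  shows "eps G {u, v} \<le> (k - 1) ^ (g div 2)"
proof -
  define A where "A = {C \<in> girth_cycles G. {u, v} \<in> C}"
  have g: "3 \<le> g" using girth_ge_3 assms(1) .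
  have "\<forall>C\<in>A. \<exists>c. cyclic_labelling g c C \<and> c 0 = v \<and> c 1 = u"
    using girth_cycle_labelling_at assms(1) unfolding A_def by blast
  then obtain lab where lab: "\<And>C. C \<in> A \<Longrightarrow> cyclic_labelling g (lab C) C"
      "\<And>C. C \<in> A \<Longrightarrow> lab C 0 = v" "\<And>C. C \<in> A \<Longrightarrow> lab C 1 = u"
    by metis
  \<comment> \<open>These are \<open>g div 2 + 2\<close> vertices: the two ends of the edge and one
    for each of the \<open>g div 2\<close> further steps.\<close>
  define start where "start C = map (\<lambda>i. lab C (int i)) [0..<Suc (Suc (g div 2))]" for C
  have "start ` A \<subseteq> walks_from v u (g div 2)"
  proof
    fix xs assume "xs \<in> start ` A"
    then obtain C where C: "C \<in> A" "xs = start C" by blast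
    have "nonbacktracking (\<lambda>i. lab C (int i)) (Suc (g div 2))"
      using nonbacktracking_labelling[OF lab(1)[OF C(1)] g, of 0] by simp
    then show "xs \<in> walks_from v u (g div 2)"
      unfolding walks_from_def C(2) start_def using lab(2,3)[OF C(1)] by force
  qed
  moreover have "inj_on start A"
  proof (rule inj_onI)
    fix C C' assume CC': "C \<in> A" "C' \<in> A" "start C = start C'"
    have "lab C (int i) = lab C' (int i)" if "i < g div 2 + 2" for i
      using CC'(3) that unfolding start_def map_eq_conv by (simp del: upt_Suc)
    then show "C = C'"
      using labelling_determined_by_half[OF assms(1)] lab(1) CC'(1,2) by blast
  qed
  ultimately have "card A \<le> card (walks_from v u (g div 2))"
    using card_walks_from[OF assms(2)] card_inj_on_le by blast
  also have "\<dots> \<le> (k - 1) ^ (g div 2)"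
    using card_walks_from[OF assms(2)] by blast
  finally show ?thesis unfolding eps_def A_def .
qed

end

section \<open>From the bound for edges to the signature\<close>

theorem theorem1p2:
  fixes G :: "'a pair_pre_digraph" and k g :: nat and a :: "nat list"
  assumes "pair_graph G"
    and "girth_regular G"
    and "has_valence G k"
    and "girth G = enat g"
    and "has_signature G a"
  shows "a ! (k - 1) \<le> (k - 1) ^ (g div 2)"
proof -
  interpret pair_graph G by fact
  \<comment> \<open>Valence and signature speak only about existing vertices. Finite girth supplies
    one: without cycles the infimum would be that of the empty set, which is
    \<open>\<infinity>\<close>.\<close>
  have "\<exists>p. graph_cycle G p"
  proof (rule ccontr)
    assume "\<nexists>p. graph_cycle G p"
    then have "{p. graph_cycle G p} = {}" by blast
    then have "girth G = \<infinity>" by (simp only: girth_def image_empty Inf_empty top_enat_def)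
    then show False using assms(4) by simp
  qed
  then obtain p where p: "graph_cycle G p" ..
  then have "p \<noteq> []" "set p \<subseteq> parcs G" unfolding graph_cycle_iff by auto
  then have "p ! 0 \<in> parcs G" by (metis length_greater_0_conv nth_mem subsetD)
  then obtain x y where xy: "(x, y) \<in> parcs G" by (metis surj_pair)
  have x: "x \<in> pverts G" using xy in_arcsD1 by blast
  have fin: "finite (incident_edges G x)"
  proof -
    have "incident_edges G x \<subseteq> (\<lambda>(u, v). {u, v}) ` parcs G"
      unfolding incident_edges_def edges_def by auto
    then show ?thesis using pair_finite_arcs finite_surj by blast
  qed
  have card: "card (incident_edges G x) = k"
    using assms(3) x unfolding has_valence_def by blast
  have "{x, y} \<in> incident_edges G x"
    using xy unfolding incident_edges_def edges_def by blast
  \<comment> \<open>This makes \<open>k - 1\<close> a valid position in \<open>a\<close>, so that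
    \<open>a ! (k - 1)\<close> is the value of \<open>eps\<close> at an edge incident with
    \<open>x\<close>.\<close>
  then have "k > 0" using card fin card_gt_0_iff by blast
  have a: "a = vertex_signature G x"
    using assms(5) x unfolding has_signature_def by simp
  have mset_a: "mset a = image_mset (eps G) (mset_set (incident_edges G x))"
    unfolding a vertex_signature_def by simp
  have "length a = k"
    using arg_cong[OF mset_a, of size] card by simp
  moreover have "set a = eps G ` incident_edges G x"
    using arg_cong[OF mset_a, of set_mset] fin by simp
  ultimately have "a ! (k - 1) \<in> eps G ` incident_edges G x"
    using \<open>k > 0\<close> by (metis diff_less less_one nth_mem)
  then obtain u v where "a ! (k - 1) = eps G {u, v}"
    unfolding incident_edges_def edges_def by blast
  then show ?thesis using eps_le assms(3,4) by simp
qed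

end
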